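(* Let $c\in[0,1]$ and consider the discrete dynamical system $$\delta(s+1)=\theta(s)\,\delta(s),\qquad \theta(s+1)=\theta(s)+c\,(1-\theta(s))\,\delta(s)\,\theta(s),\qquad s=0,1,2,\ldots$$ defined on $\mathcal{D}=\{(\delta,\theta) : \delta\in[0,0.5],\ \theta\in[0,1)\}$. If the initial condition $(\delta(0),\theta(0))\in\mathcal{D}$ satisfies $$c\,\delta(0)+\theta(0)<1,$$ then the system converges to consensus, i.e. $\delta(s)\to 0$ as $s\to\infty$.
   Context: The system models two agents with equal influence weights $1/2$ and equal stubbornness $\theta(s)$ discussing a sequence of issues $s=0,1,2,\ldots$; $\delta(s)$ is the distance of each agent's opinion from the median (equivalently mean) opinion at the start of issue $s$, and $c$ is the stubbornness-update gain. In this setting "consensus" means $\delta(s)\to0$ as $s\to\infty$. *)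

theory Defs
  imports Complex_Main
begin

definition state_domain :: "(real \<times> real) set" where
  "state_domain = {(\<delta>, \<theta>). \<delta> \<in> {0..1/2} \<and> \<theta> \<in> {0..<1}}"

definition is_trajectory :: "real \<Rightarrow> (nat \<Rightarrow> real) \<Rightarrow> (nat \<Rightarrow> real) \<Rightarrow> bool" where
  "is_trajectory c \<delta> \<theta> \<longleftrightarrow>
     (\<forall>s. \<delta> (Suc s) = \<theta> s * \<delta> s \<and>
          \<theta> (Suc s) = \<theta> s + c * (1 - \<theta> s) * \<delta> s * \<theta> s)"

end

(* The quantity c * \<delta> + \<theta> decreases along trajectories, by c * \<delta> * (1 - \<theta>)^2 at each step.
   Its initial value q < 1 therefore bounds every \<theta> s, and \<delta> decays at least as fast as q ^ s. *)
theory Submission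
  imports Defs
begin

text \<open>The four bounds need a joint induction: the signs of \<open>\<delta> s\<close> and
  \<open>\<theta> s\<close> make the decrement nonnegative and give
  \<open>\<theta> s \<le> q\<close>, which is the contraction factor for
  \<open>\<delta>\<close>.\<close>

lemma trajectory_geometric_bound:
  fixes c :: real and \<delta> \<theta> :: "nat \<Rightarrow> real"
  assumes c: "0 \<le> c"
    and traj: "is_trajectory c \<delta> \<theta>"
    and init: "0 \<le> \<delta> 0" "0 \<le> \<theta> 0" "c * \<delta> 0 + \<theta> 0 \<le> q"
    and q: "q \<le> 1"
  shows "0 \<le> \<delta> s \<and> \<delta> s \<le> q ^ s * \<delta> 0 \<and> 0 \<le> \<theta> s \<and> c * \<delta> s + \<theta> s \<le> q"
proof (induction s)
  case 0
  show ?case using init by simp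
next
  case (Suc s)
  have d: "\<delta> (Suc s) = \<theta> s * \<delta> s"
    and t: "\<theta> (Suc s) = \<theta> s + c * (1 - \<theta> s) * \<delta> s * \<theta> s"
    using traj by (auto simp: is_trajectory_def)
  have "0 \<le> c * \<delta> s" using c Suc.IH by simp
  then have \<theta>_le: "\<theta> s \<le> q" using Suc.IH by linarith
  then have \<theta>_le_1: "\<theta> s \<le> 1" using q by linarith
  \<comment> \<open>On the left, the terms besides \<open>\<theta> s\<close> add up to
    \<open>c * \<delta> s * \<theta> s * (2 - \<theta> s)\<close>, and x (2 - x) = 1 - (1 -
    x)^2.\<close>
  have "c * \<delta> (Suc s) + \<theta> (Suc s) = (c * \<delta> s + \<theta> s) - c * \<delta> s * (1 - \<theta> s)\<^sup>2"
    unfolding d t by (simp add: power2_eq_square algebra_simps)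
  moreover have "0 \<le> c * \<delta> s * (1 - \<theta> s)\<^sup>2" using \<open>0 \<le> c * \<delta> s\<close> by simp
  ultimately have "c * \<delta> (Suc s) + \<theta> (Suc s) \<le> q" using Suc.IH by linarith
  \<comment> \<open>Here \<open>\<theta> s \<le> 1\<close> makes the increment of
    \<open>\<theta>\<close> nonnegative.\<close>
  moreover have "0 \<le> \<theta> (Suc s)" unfolding t using c Suc.IH \<theta>_le_1 by simp
  moreover have "0 \<le> \<delta> (Suc s)" unfolding d using Suc.IH by simp
  moreover have "\<delta> (Suc s) \<le> q ^ Suc s * \<delta> 0"
  proof -
    have "\<theta> s * \<delta> s \<le> q * (q ^ s * \<delta> 0)"
      using Suc.IH \<theta>_le by (intro mult_mono) auto
    then show ?thesis unfolding d by (simp add: mult.assoc)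
  qed
  ultimately show ?case by blast
qed

theorem mainTheorem1:
  fixes c :: real and \<delta> \<theta> :: "nat \<Rightarrow> real"
  assumes "c \<in> {0..1}"
    and "is_trajectory c \<delta> \<theta>"
    and "(\<delta> 0, \<theta> 0) \<in> state_domain"
    and "c * \<delta> 0 + \<theta> 0 < 1"
  shows "\<delta> \<longlonglongrightarrow> 0"
proof -
  define q where "q = c * \<delta> 0 + \<theta> 0"
  have init: "0 \<le> \<delta> 0" "0 \<le> \<theta> 0" "0 \<le> c"
    using assms(1,3) by (auto simp: state_domain_def)
  have q: "0 \<le> q" "q < 1" using init assms(4) by (auto simp: q_def)
  have bound: "0 \<le> \<delta> s \<and> \<delta> s \<le> q ^ s * \<delta> 0" for s
    using trajectory_geometric_bound[of c \<delta> \<theta> q s] init assms(2) q by (auto simp: q_def)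
  have "(\<lambda>s. q ^ s * \<delta> 0) \<longlonglongrightarrow> 0"
    using q by (intro tendsto_mult_left_zero LIMSEQ_realpow_zero)
  then show ?thesis
    \<comment> \<open>Squeeze between the constant 0 and the geometric bound; the rotation puts the
      limit of the upper bound first, to match the chained fact.\<close>
    by (rule tendsto_sandwich[OF _ _ tendsto_const, rotated 2]) (use bound in auto)
qed

end
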